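(* Let $K$ be a finite simplicial complex with vertex set $V$, $|V|=n$, let $f\colon V\to\{1,\dots,n\}$ be an order function (a bijection), and let $F_f$ be the colex vector field induced by $f$. Then there are no nontrivial closed $F_f$-paths.
   Context: Simplices are nonempty finite subsets of $V$; $K$ is closed under taking nonempty subsets. For $\sigma\in K$, $V_\sigma=\{v\in V\mid\{v\}\cup\sigma\in K\}$ and the candidate vertex is $c_f(\sigma)=\operatorname{argmin}_{v\in V_\sigma}f(v)$. The colex vector field $F_f$ is the collection of pairs (arrows) $\{\alpha\to\beta\}$ of simplices of $K$ of dimensions $p$ and $p+1$ (any $p\ge0$) such that $\beta=\{c_f(\alpha)\}\cup\alpha$ and $c_f(\alpha)\notin\alpha$. For a discrete vector field $F$, an $F$-path is a sequence of simplices $\alpha_0^{(p)},\beta_0^{(p+1)},\alpha_1^{(p)},\beta_1^{(p+1)},\dots,\beta_r^{(p+1)},\alpha_{r+1}^{(p)}$ (superscripts denote dimension) such that for each $i\in\{0,\dots,r\}$: $\{\alpha_i\to\beta_i\}\in F$, $\alpha_{i+1}$ is a proper face of $\beta_i$, and $\alpha_i\ne\alpha_{i+1}$. It is nontrivial if $r\ge0$ and closed if $\alpha_0=\alpha_{r+1}$. *)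

theory Defs
  imports Main
begin

text \<open>
  Simplices are nonempty, so the empty set is not a simplex. It is not required that every singleton
  of elements of \<open>V\<close> belongs to \<open>K\<close>.
\<close>

definition finite_simplicial_complex :: "'a set \<Rightarrow> 'a set set \<Rightarrow> bool" where
  "finite_simplicial_complex V K \<longleftrightarrow>
     finite V \<and>
     (\<forall>\<sigma>\<in>K. \<sigma> \<noteq> {} \<and> finite \<sigma> \<and> \<sigma> \<subseteq> V) \<and>
     (\<forall>\<sigma>\<in>K. \<forall>\<tau>. \<tau> \<noteq> {} \<and> \<tau> \<subseteq> \<sigma> \<longrightarrow> \<tau> \<in> K)"

text \<open>Truncated subtraction is harmless here, since it is only used for nonempty finite sets.\<close>

definition simplex_dim :: "'a set \<Rightarrow> nat" where
  "simplex_dim \<sigma> = card \<sigma> - 1"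

definition coface_vertices :: "'a set \<Rightarrow> 'a set set \<Rightarrow> 'a set \<Rightarrow> 'a set" where
  "coface_vertices V K \<sigma> = {v \<in> V. {v} \<union> \<sigma> \<in> K}"

text \<open>
  For \<open>\<sigma> \<in> K\<close> the set \<open>coface_vertices V K \<sigma>\<close> contains \<open>\<sigma>\<close>, so it is nonempty; if moreover \<open>f\<close> is
  injective on \<open>V\<close>, the minimiser is unique.
\<close>

definition candidate_vertex :: "'a set \<Rightarrow> 'a set set \<Rightarrow> ('a \<Rightarrow> nat) \<Rightarrow> 'a set \<Rightarrow> 'a" where
  "candidate_vertex V K f \<sigma> = arg_min_on f (coface_vertices V K \<sigma>)"

text \<open>An arrow \<open>\<alpha> \<rightarrow> \<beta>\<close> is encoded as the pair \<open>(\<alpha>, \<beta>)\<close>.\<close>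

definition colex_vector_field ::
  "'a set \<Rightarrow> 'a set set \<Rightarrow> ('a \<Rightarrow> nat) \<Rightarrow> ('a set \<times> 'a set) set" where
  "colex_vector_field V K f =
     {(\<alpha>, \<beta>). \<alpha> \<in> K \<and> \<beta> \<in> K \<and> simplex_dim \<beta> = simplex_dim \<alpha> + 1 \<and>
        \<beta> = {candidate_vertex V K f \<alpha>} \<union> \<alpha> \<and> candidate_vertex V K f \<alpha> \<notin> \<alpha>}"

text \<open>
  The alternating sequence of simplices is given by the list \<open>as\<close> of the \<open>\<alpha>\<^sub>i\<close> (for \<open>0 \<le> i \<le> r + 1\<close>)
  and the list \<open>bs\<close> of the \<open>\<beta>\<^sub>i\<close> (for \<open>0 \<le> i \<le> r\<close>), so \<open>length bs = r + 1\<close>, and \<open>bs = []\<close> for the trivial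
  path, that is \<open>r = -1\<close>.
\<close>

definition is_path ::
  "'a set set \<Rightarrow> ('a set \<times> 'a set) set \<Rightarrow> nat \<Rightarrow> 'a set list \<Rightarrow> 'a set list \<Rightarrow> bool" where
  "is_path K F p as bs \<longleftrightarrow>
     length as = length bs + 1 \<and>
     (\<forall>\<alpha>\<in>set as. \<alpha> \<in> K \<and> simplex_dim \<alpha> = p) \<and>
     (\<forall>\<beta>\<in>set bs. \<beta> \<in> K \<and> simplex_dim \<beta> = p + 1) \<and>
     (\<forall>i<length bs. (as ! i, bs ! i) \<in> F \<and> as ! (i + 1) \<subset> bs ! i \<and> as ! i \<noteq> as ! (i + 1))"

definition nontrivial_path :: "'a set list \<Rightarrow> 'a set list \<Rightarrow> bool" where
  "nontrivial_path as bs \<longleftrightarrow> length bs \<ge> 1"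

definition closed_path :: "'a set list \<Rightarrow> 'a set list \<Rightarrow> bool" where
  "closed_path as bs \<longleftrightarrow> as ! 0 = as ! length bs"

end

theory Submission
  imports Defs
begin

text \<open>
  Along an \<open>F\<^sub>f\<close>-path the weight \<open>\<Sum>v\<in>\<alpha>\<^sub>i. f v\<close> strictly decreases: \<open>\<alpha>\<^sub>i\<^sub>+\<^sub>1\<close> arises from \<open>\<alpha>\<^sub>i\<close> by adding
  \<open>c\<^sub>f(\<alpha>\<^sub>i)\<close> and deleting some \<open>u \<in> \<alpha>\<^sub>i\<close>. As \<open>u\<close> belongs to \<open>V\<close> and to \<open>\<alpha>\<^sub>i\<close>, it competes with
  \<open>c\<^sub>f(\<alpha>\<^sub>i)\<close> in the minimisation, whence \<open>f (c\<^sub>f(\<alpha>\<^sub>i)) < f u\<close> by injectivity.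
\<close>

text \<open>Adjoining to \<alpha> one of its own vertices gives back \<alpha>, which lies in
  \<open>K\<close>.\<close>

lemma simplex_subset_coface_vertices:
  assumes "finite_simplicial_complex V K" and "\<alpha> \<in> K"
  shows "\<alpha> \<subseteq> coface_vertices V K \<alpha>"
proof
  fix v assume v: "v \<in> \<alpha>"
  have "\<alpha> \<subseteq> V"
    using assms by (simp add: finite_simplicial_complex_def)
  with v assms(2) show "v \<in> coface_vertices V K \<alpha>"
    by (auto simp: coface_vertices_def insert_absorb)
qed

lemma candidate_vertex_less:
  assumes K: "finite_simplicial_complex V K" and inj: "inj_on f V"
    and "\<alpha> \<in> K" "u \<in> \<alpha>" "candidate_vertex V K f \<alpha> \<notin> \<alpha>"
  shows "f (candidate_vertex V K f \<alpha>) < f u"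
proof -
  let ?C = "coface_vertices V K \<alpha>"
  have C: "finite ?C" "?C \<subseteq> V"
    using K by (auto simp: finite_simplicial_complex_def coface_vertices_def)
  have u: "u \<in> ?C"
    using simplex_subset_coface_vertices[OF K \<open>\<alpha> \<in> K\<close>] \<open>u \<in> \<alpha>\<close> by blast
  \<comment> \<open>The witness \<open>u\<close> makes \<open>?C\<close> nonempty, so the minimum is
    attained.\<close>
  have c: "candidate_vertex V K f \<alpha> \<in> ?C"
    unfolding candidate_vertex_def using arg_min_if_finite(1)[OF C(1), of f] u by blast
  have "f (candidate_vertex V K f \<alpha>) \<le> f u"
    unfolding candidate_vertex_def using arg_min_least[OF C(1) _ u] u by blast
  \<comment> \<open>Equality would force the candidate vertex to be \<open>u\<close>, which lies in
    \<alpha>.\<close>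
  moreover have "f (candidate_vertex V K f \<alpha>) \<noteq> f u"
    using inj_onD[OF inj] c u C(2) assms(4,5) by blast
  ultimately show ?thesis by simp
qed

lemma sum_decreases_along_arrow:
  assumes K: "finite_simplicial_complex V K" and inj: "inj_on f V"
    and arrow: "(\<alpha>, \<beta>) \<in> colex_vector_field V K f"
    and \<alpha>': "\<alpha>' \<in> K" "simplex_dim \<alpha>' = simplex_dim \<alpha>" "\<alpha>' \<subset> \<beta>" "\<alpha> \<noteq> \<alpha>'"
  shows "sum f \<alpha>' < sum f \<alpha>"
proof -
  define c where "c = candidate_vertex V K f \<alpha>"
  have \<alpha>: "\<alpha> \<in> K" and \<beta>: "\<beta> = insert c \<alpha>" and c: "c \<notin> \<alpha>"
    using arrow by (simp_all add: colex_vector_field_def c_def)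
  have simplex: "finite \<sigma>" "\<sigma> \<noteq> {}" if "\<sigma> \<in> K" for \<sigma>
    using K that by (simp_all add: finite_simplicial_complex_def)
  note fin = simplex(1)[OF \<alpha>] simplex(1)[OF \<alpha>'(1)]
  \<comment> \<open>Truncated subtraction gives cardinalities 0 and 1 the same dimension;
    nonemptiness excludes 0.\<close>
  have "card \<alpha> > 0" "card \<alpha>' > 0"
    using simplex \<alpha> \<alpha>'(1) by (simp_all add: card_gt_0_iff)
  then have card: "card \<alpha>' = card \<alpha>"
    using \<alpha>'(2) by (simp add: simplex_dim_def)
  obtain u where u: "u \<in> \<beta>" "u \<notin> \<alpha>'"
    using \<alpha>'(3) by blast
  \<comment> \<open>\<beta> has exactly one vertex more than \<alpha>, hence one more than
    \<alpha>', so \<open>u\<close> is the only vertex that \<alpha>' omits.\<close>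
  have eq: "\<alpha>' = \<beta> - {u}"
  proof (rule card_subset_eq)
    show "card \<alpha>' = card (\<beta> - {u})"
      using u(1) fin(1) c card by (simp add: \<beta>)
  qed (use u \<alpha>'(3) fin \<beta> in auto)
  \<comment> \<open>Omitting \<open>c\<close> instead would give back \<alpha>, contrary to \<alpha>
    \<noteq> \<alpha>'.\<close>
  have "u \<in> \<alpha>"
    using u eq \<beta> c \<alpha>'(4) by auto
  \<comment> \<open>Evaluating the sum over \<beta> in two ways avoids subtraction of
    naturals.\<close>
  have "sum f \<alpha>' + f u = sum f \<beta>"
    using sum.remove[of \<beta> u f] u(1) fin(1) unfolding eq by (simp add: \<beta>)
  also have "\<dots> = f c + sum f \<alpha>"
    using \<beta> fin c by simp
  also have "f c < f u"
    using candidate_vertex_less[OF K inj \<alpha> \<open>u \<in> \<alpha>\<close>] c by (simp add: c_def)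
  finally show ?thesis by simp
qed

theorem proposition3p6:
  fixes V :: "'a set" and K :: "'a set set" and f :: "'a \<Rightarrow> nat" and n :: nat
  assumes "finite_simplicial_complex V K"
    and "card V = n"
    and "bij_betw f V {1..n}"
  shows "\<not> (\<exists>p as bs. is_path K (colex_vector_field V K f) p as bs \<and>
                nontrivial_path as bs \<and> closed_path as bs)"
proof (intro notI, elim exE conjE)
  fix p as bs
  assume path: "is_path K (colex_vector_field V K f) p as bs"
    and nontriv: "nontrivial_path as bs" and closed: "closed_path as bs"
  have inj: "inj_on f V"
    using assms(3) by (rule bij_betw_imp_inj_on)
  have step: "sum f (as ! Suc i) < sum f (as ! i)" if i: "i < length bs" for i
  proof (rule sum_decreases_along_arrow[OF assms(1) inj])
    have "as ! i \<in> set as" and "as ! Suc i \<in> set as"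
      using path i by (simp_all add: is_path_def)
    with path show "as ! Suc i \<in> K" and "simplex_dim (as ! Suc i) = simplex_dim (as ! i)"
      by (simp_all add: is_path_def)
    show "(as ! i, bs ! i) \<in> colex_vector_field V K f" and "as ! Suc i \<subset> bs ! i"
      and "as ! i \<noteq> as ! Suc i"
      using path i by (simp_all add: is_path_def)
  qed
  \<comment> \<open>Each step lowers the natural-number weight by at least 1. At
    \<open>i = length bs\<close>, closedness makes the two sums equal, which forces
    \<open>length bs = 0\<close>.\<close>
  have "sum f (as ! i) + i \<le> sum f (as ! 0)" if "i \<le> length bs" for i
    using that
  proof (induction i)
    case (Suc i)
    then show ?case using step[of i] by simp
  qed simp
  from this[of "length bs"] show False
    using nontriv closed by (simp add: nontrivial_path_def closed_path_def)
qed

end
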